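(* Let $n \geqslant r \geqslant 3$ and $k \geqslant 2$ be integers, and let $H$ be the balanced complete $k$-partite $r$-uniform hypergraph with $n$ vertices in each class. The following $2$-coloring (colors red and blue) of the vertices of $H$ minimizes the number of monochromatic edges of $H$ among all $2$-colorings: (1) color all vertices of the first $\lfloor k/2\rfloor$ classes red; (2) color all vertices of the last $\lfloor k/2\rfloor$ classes blue; (3) if there is another class (i.e. $k$ is odd), color the vertices of that class so that the numbers of red and blue vertices in it are as equal as possible (i.e. they differ by at most $1$). Moreover, this minimizing coloring is unique up to a permutation of colors and classes.
   Context: The balanced complete $k$-partite $r$-uniform hypergraph with $n$ vertices in each class has vertex set the disjoint union of $k$ classes $V_1,\dots,V_k$ with $|V_i|=n$, and its edges are all $r$-element subsets of $V_1\cup\dots\cup V_k$ that are not contained in a single class $V_i$ (an edge may contain several vertices of the same class). A $2$-coloring assigns to each vertex one of two colors (not required to be proper). An edge is monochromatic if all its vertices have the same color. Colorings having the same number of vertices of each color in each class are regarded as the same coloring; "unique up to a permutation of colors and classes" means that every minimizing coloring is obtained from the described one by permuting the names of the colors and permuting the classes. *)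

theory Defs
  imports "HOL-Combinatorics.Permutations"
begin

datatype color = Red | Blue

type_synonym vertex = "nat \<times> nat"

text \<open>The pair \<open>(i, j)\<close> is the \<open>j\<close>-th vertex of the \<open>i\<close>-th class; classes are numbered \<open>1, ..., k\<close>.\<close>

definition vclass :: "nat \<Rightarrow> nat \<Rightarrow> vertex set" where
  "vclass n i = {i} \<times> {1..n}"

definition vertices :: "nat \<Rightarrow> nat \<Rightarrow> vertex set" where
  "vertices n k = (\<Union>i\<in>{1..k}. vclass n i)"

definition edges :: "nat \<Rightarrow> nat \<Rightarrow> nat \<Rightarrow> vertex set set" where
  "edges n k r =
     {e. e \<subseteq> vertices n k \<and> card e = r \<and> \<not> (\<exists>i\<in>{1..k}. e \<subseteq> vclass n i)}"

text \<open>A 2-coloring is a total function on vertices; only its values on \<open>vertices n k\<close> matter.\<close>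

definition monochromatic :: "('v \<Rightarrow> color) \<Rightarrow> 'v set \<Rightarrow> bool" where
  "monochromatic f e \<longleftrightarrow> (\<exists>c. \<forall>v\<in>e. f v = c)"

definition num_mono :: "nat \<Rightarrow> nat \<Rightarrow> nat \<Rightarrow> (vertex \<Rightarrow> color) \<Rightarrow> nat" where
  "num_mono n k r f = card {e \<in> edges n k r. monochromatic f e}"

definition minimizing :: "nat \<Rightarrow> nat \<Rightarrow> nat \<Rightarrow> (vertex \<Rightarrow> color) \<Rightarrow> bool" where
  "minimizing n k r f \<longleftrightarrow> (\<forall>g. num_mono n k r f \<le> num_mono n k r g)"

definition color_count :: "nat \<Rightarrow> (vertex \<Rightarrow> color) \<Rightarrow> nat \<Rightarrow> color \<Rightarrow> nat" where
  "color_count n f i c = card {v \<in> vclass n i. f v = c}"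

text \<open>The last condition concerns the class \<open>(k + 1) div 2\<close> if \<open>k\<close> is odd, and no class if \<open>k\<close> is
  even. If \<open>n\<close> and \<open>k\<close> are both odd, either color may have the extra vertex.\<close>

definition balanced_coloring :: "nat \<Rightarrow> nat \<Rightarrow> (vertex \<Rightarrow> color) \<Rightarrow> bool" where
  "balanced_coloring n k f \<longleftrightarrow>
     (\<forall>i\<in>{1..k div 2}. \<forall>v\<in>vclass n i. f v = Red) \<and>
     (\<forall>i\<in>{k - k div 2 <..k}. \<forall>v\<in>vclass n i. f v = Blue) \<and>
     (\<forall>i\<in>{k div 2 <..k - k div 2}.
        \<bar>int (color_count n f i Red) - int (color_count n f i Blue)\<bar> \<le> 1)"

text \<open>Colorings with the same number of vertices of each color in each class are identified, so
  permuting colors and classes is expressed on the level of these numbers.\<close>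

definition same_up_to_permutation ::
    "nat \<Rightarrow> nat \<Rightarrow> (vertex \<Rightarrow> color) \<Rightarrow> (vertex \<Rightarrow> color) \<Rightarrow> bool" where
  "same_up_to_permutation n k f g \<longleftrightarrow>
     (\<exists>\<pi> \<sigma>. \<pi> permutes {1..k} \<and> bij \<sigma> \<and>
        (\<forall>i\<in>{1..k}. \<forall>c. color_count n g (\<pi> i) (\<sigma> c) = color_count n f i c))"

lemma balanced_coloring_exists: "\<exists>f. balanced_coloring n k f"
proof -
  define f :: "vertex \<Rightarrow> color" where
    "f = (\<lambda>(i, j). if i \<le> k div 2 then Red else if k - k div 2 < i then Blue
            else if j \<le> n div 2 then Red else Blue)"
  have mid: "\<bar>int (color_count n f i Red) - int (color_count n f i Blue)\<bar> \<le> 1"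
    if i: "i \<in> {k div 2 <..k - k div 2}" for i
  proof -
    have "{v \<in> vclass n i. f v = Red} = {i} \<times> {1..n div 2}"
      using i by (auto simp: vclass_def f_def split: if_splits)
    moreover have "{v \<in> vclass n i. f v = Blue} = {i} \<times> {Suc (n div 2)..n}"
      using i by (auto simp: vclass_def f_def split: if_splits)
    ultimately show ?thesis
      by (simp add: color_count_def card_cartesian_product)
  qed
  have "balanced_coloring n k f"
    unfolding balanced_coloring_def using mid by (auto simp: f_def vclass_def)
  then show ?thesis by blast
qed

end

theory Submission
  imports Defs
begin

text \<open>If class \<open>i\<close> has \<open>a\<^sub>i\<close> red vertices, the number of monochromatic edges is
  \<open>C(\<Sum> a\<^sub>i, r) + C(\<Sum> (n - a\<^sub>i), r) - \<Sum> (C(a\<^sub>i, r) + C(n - a\<^sub>i, r))\<close>. By convexity of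
  \<open>x \<mapsto> C(x, r)\<close>, two bicolored classes can be improved by moving red vertices from one to the other
  until one of them is unicolored. With one bicolored class left, \<open>p\<close> red and \<open>q\<close> blue classes,
  recoloring a single vertex compares \<open>C(pn + y, r - 1) - C(y, r - 1)\<close> with
  \<open>C(qn + z, r - 1) - C(z, r - 1)\<close>, which forces \<open>p = q\<close> and a balanced bicolored class.\<close>

section \<open>Monotonicity and convexity of binomial coefficients\<close>

lemma binomial_strict_mono:
  assumes "u < v" "0 < r" "r \<le> v"
  shows "u choose r < v choose r"
proof -
  obtain v' where v: "v = Suc v'" using assms(1) by (cases v) auto
  obtain s where s: "r = Suc s" using assms(2) by (cases r) auto
  have "u choose r \<le> v' choose r"
    using assms v by (intro binomial_right_mono) auto
  \<comment> \<open>Pascal's rule adds \<open>v' choose s\<close>, which is positive because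
    \<open>s \<le> v'\<close>.\<close>
  also have "\<dots> < v choose r"
    using assms v s by simp
  finally show ?thesis .
qed

text \<open>Raising \<open>x\<close> by one raises \<open>x choose r\<close> by
  \<open>x choose (r - 1)\<close>, which is monotone in \<open>x\<close>; each of the
  \<open>t\<close> increments from \<open>v\<close> thus dominates the corresponding one from
  \<open>u\<close>.\<close>

lemma binomial_convex:
  assumes "u \<le> v"
  shows "((u + t) choose r) + (v choose r) \<le> (u choose r) + ((v + t) choose r)"
proof (induction t)
  case (Suc t)
  show ?case
  proof (cases r)
    case (Suc s)
    have "(u + t) choose s \<le> (v + t) choose s"
      using assms by (intro binomial_right_mono) auto
    then show ?thesis using Suc.IH Suc by simp
  qed auto
qed auto

text \<open>One strict increment is enough, and it is the last: \<open>r \<le> v + t\<close> makes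
  it strict even where the earlier increments vanish on both sides.\<close>

lemma binomial_strict_convex:
  assumes "u < v" "0 < t" "2 \<le> r" "r \<le> v + t"
  shows "((u + t) choose r) + (v choose r) < (u choose r) + ((v + t) choose r)"
proof -
  obtain t' where t: "t = Suc t'" using assms(2) by (cases t) auto
  obtain s where s: "r = Suc s" using assms(3) by (cases r) auto
  have "(u + t') choose s < (v + t') choose s"
    using assms t s by (intro binomial_strict_mono) auto
  with binomial_convex[of u v t' r] assms(1) show ?thesis by (simp add: t s)
qed

lemma binomial_superadditive:
  assumes "0 < r"
  shows "(u choose r) + (v choose r) \<le> (u + v) choose r"
  using binomial_convex[of 0 v u r] assms by (cases r) (auto simp: add.commute)

section \<open>Counting monochromatic edges through the red counts of the classes\<close>

text \<open>Here \<open>a i\<close> stands for the number of red vertices of class \<open>i\<close>.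
  The values are integers because subtraction on \<open>nat\<close> truncates.\<close>

definition mono_value :: "nat \<Rightarrow> nat \<Rightarrow> nat \<Rightarrow> (nat \<Rightarrow> nat) \<Rightarrow> int" where
  "mono_value n k r a =
     int ((\<Sum>i\<in>{1..k}. a i) choose r) + int ((\<Sum>i\<in>{1..k}. n - a i) choose r)
     - (\<Sum>i\<in>{1..k}. int (a i choose r) + int ((n - a i) choose r))"

lemma finite_vclass [simp]: "finite (vclass n i)"
  by (simp add: vclass_def)

lemma card_vclass [simp]: "card (vclass n i) = n"
  by (simp add: vclass_def card_cartesian_product)

lemma vclass_disjoint: "i \<noteq> j \<Longrightarrow> vclass n i \<inter> vclass n j = {}"
  by (auto simp: vclass_def)

lemma color_count_add: "color_count n f i Red + color_count n f i Blue = n"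
proof -
  have "vclass n i = {v \<in> vclass n i. f v = Red} \<union> {v \<in> vclass n i. f v = Blue}"
    using color.exhaust by auto
  then have "card (vclass n i) = color_count n f i Red + color_count n f i Blue"
    unfolding color_count_def by (subst card_Un_disjoint[symmetric]) auto
  then show ?thesis by simp
qed

lemma color_count_Red_le: "color_count n f i Red \<le> n"
  using color_count_add[of n f i] by simp

lemma color_count_Blue: "color_count n f i Blue = n - color_count n f i Red"
  using color_count_add[of n f i] by simp

lemma card_color_vertices:
  "card {v \<in> vertices n k. f v = c} = (\<Sum>i\<in>{1..k}. color_count n f i c)"
proof -
  have "{v \<in> vertices n k. f v = c} = (\<Union>i\<in>{1..k}. {v \<in> vclass n i. f v = c})"
    by (auto simp: vertices_def)
  also have "card \<dots> = (\<Sum>i\<in>{1..k}. color_count n f i c)"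
    unfolding color_count_def using vclass_disjoint by (subst card_UN_disjoint) auto
  finally show ?thesis .
qed

text \<open>A nonempty monochromatic set has exactly one color. The empty set would be counted for
  both, hence \<open>0 < r\<close>.\<close>

lemma card_monochromatic_subsets:
  fixes f :: "'v \<Rightarrow> color"
  assumes "finite A" "0 < r"
  shows "card {e. e \<subseteq> A \<and> card e = r \<and> monochromatic f e} =
    (card {v \<in> A. f v = Red} choose r) + (card {v \<in> A. f v = Blue} choose r)"
proof -
  let ?S = "\<lambda>c. {e. e \<subseteq> {v \<in> A. f v = c} \<and> card e = r}"
  have fin: "finite (?S c)" for c
    using assms(1) by simp
  have "{e. e \<subseteq> A \<and> card e = r \<and> monochromatic f e} = ?S Red \<union> ?S Blue"
  proof (intro equalityI subsetI)
    fix e assume "e \<in> {e. e \<subseteq> A \<and> card e = r \<and> monochromatic f e}"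
    then obtain c where "e \<in> ?S c"
      unfolding monochromatic_def by blast
    then show "e \<in> ?S Red \<union> ?S Blue" by (cases c) auto
  qed (auto simp: monochromatic_def)
  moreover have "?S Red \<inter> ?S Blue = {}"
  proof (intro equals0I)
    fix e assume "e \<in> ?S Red \<inter> ?S Blue"
    then have "\<forall>v\<in>e. f v = Red \<and> f v = Blue" "card e = r" by auto
    then have "e = {}" "card e = r" by auto
    then show False using assms(2) by simp
  qed
  ultimately have "card {e. e \<subseteq> A \<and> card e = r \<and> monochromatic f e} = card (?S Red) + card (?S Blue)"
    using fin by (simp add: card_Un_disjoint)
  then show ?thesis using assms(1) by (simp add: n_subsets)
qed

text \<open>The monochromatic \<open>r\<close>-sets of vertices are the monochromatic edges together
  with the sets inside a single class. As \<open>r > 0\<close>, no set lies inside two classes, so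
  the latter are counted class by class.\<close>

lemma num_mono_eq_mono_value:
  assumes "0 < r"
  shows "int (num_mono n k r f) = mono_value n k r (\<lambda>i. color_count n f i Red)"
proof -
  let ?M = "\<lambda>A. {e. e \<subseteq> A \<and> card e = r \<and> monochromatic f e}"
  let ?E = "{e \<in> edges n k r. monochromatic f e}"
  let ?C = "\<Union>i\<in>{1..k}. ?M (vclass n i)"
  have finV: "finite (vertices n k)" by (simp add: vertices_def)
  have "vclass n i \<subseteq> vertices n k" if "i \<in> {1..k}" for i
    using that by (auto simp: vertices_def)
  then have split: "?M (vertices n k) = ?E \<union> ?C"
    unfolding edges_def by blast
  have disj: "?E \<inter> ?C = {}"
    unfolding edges_def by blast
  have finM: "finite (?M A)" if "finite A" for A
    using that by simp
  have "finite ?E"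
    by (rule finite_subset[OF _ finM[OF finV]]) (auto simp: edges_def)
  moreover have "finite ?C" by (intro finite_UN_I finM finite_vclass finite_atLeastAtMost)
  ultimately have "card (?M (vertices n k)) = num_mono n k r f + card ?C"
    unfolding num_mono_def split using disj by (rule card_Un_disjoint)
  moreover have "card ?C = (\<Sum>i\<in>{1..k}. card (?M (vclass n i)))"
  proof (rule card_UN_disjoint)
    have "?M (vclass n i) \<inter> ?M (vclass n j) = {}" if "i \<noteq> j" for i j
    proof (intro equals0I)
      fix e assume e: "e \<in> ?M (vclass n i) \<inter> ?M (vclass n j)"
      then have "e \<subseteq> vclass n i \<inter> vclass n j" by blast
      then have "e = {}" using vclass_disjoint[OF that] by simp
      with e show False using assms by simp
    qed
    then show "\<forall>i\<in>{1..k}. \<forall>j\<in>{1..k}. i \<noteq> j \<longrightarrow> ?M (vclass n i) \<inter> ?M (vclass n j) = {}"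
      by blast
    show "\<forall>i\<in>{1..k}. finite (?M (vclass n i))"
      by (intro ballI finM finite_vclass)
  qed (rule finite_atLeastAtMost)
  ultimately have "num_mono n k r f + (\<Sum>i\<in>{1..k}. card (?M (vclass n i))) = card (?M (vertices n k))"
    by simp
  then have "num_mono n k r f
      + (\<Sum>i\<in>{1..k}. (color_count n f i Red choose r) + (color_count n f i Blue choose r))
    = ((\<Sum>i\<in>{1..k}. color_count n f i Red) choose r)
      + ((\<Sum>i\<in>{1..k}. color_count n f i Blue) choose r)"
    by (simp only: card_monochromatic_subsets[OF finV assms] card_color_vertices
        card_monochromatic_subsets[OF finite_vclass assms] color_count_def[symmetric])
  from arg_cong[OF this, of int]
  have "int (num_mono n k r f)
      + (\<Sum>i\<in>{1..k}. int (color_count n f i Red choose r) + int (color_count n f i Blue choose r))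
    = int ((\<Sum>i\<in>{1..k}. color_count n f i Red) choose r)
      + int ((\<Sum>i\<in>{1..k}. color_count n f i Blue) choose r)"
    by (simp only: of_nat_add of_nat_sum)
  then show ?thesis
    unfolding mono_value_def color_count_Blue by linarith
qed

text \<open>Every profile of red counts is realized, so minimizing over colorings amounts to
  minimizing \<open>mono_value\<close> over profiles bounded by \<open>n\<close>.\<close>

lemma coloring_with_counts:
  assumes "\<And>i. i \<in> {1..k} \<Longrightarrow> a i \<le> n"
  obtains g where "\<And>i. i \<in> {1..k} \<Longrightarrow> color_count n g i Red = a i"
proof
  define g :: "vertex \<Rightarrow> color" where "g = (\<lambda>(i, j). if j \<le> a i then Red else Blue)"
  fix i assume i: "i \<in> {1..k}"
  have "{v \<in> vclass n i. g v = Red} = {i} \<times> {1..a i}"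
    using assms[OF i] by (auto simp: vclass_def g_def split: if_splits)
  then show "color_count n g i Red = a i"
    by (simp add: color_count_def card_cartesian_product)
qed

lemma mono_value_cong:
  assumes "\<And>i. i \<in> {1..k} \<Longrightarrow> a i = b i"
  shows "mono_value n k r a = mono_value n k r b"
proof -
  have eq: "(\<Sum>i\<in>{1..k}. h (a i)) = (\<Sum>i\<in>{1..k}. h (b i))" for h :: "nat \<Rightarrow> 'b::comm_monoid_add"
    using assms by (intro sum.cong) auto
  show ?thesis
    using eq[of "\<lambda>x. x"] eq[of "\<lambda>x. n - x"] eq[of "\<lambda>x. int (x choose r) + int ((n - x) choose r)"]
    by (simp only: mono_value_def)
qed

lemma minimizing_mono_value_le:
  assumes "minimizing n k r g" "0 < r" "\<And>i. i \<in> {1..k} \<Longrightarrow> b i \<le> n"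
  shows "mono_value n k r (\<lambda>i. color_count n g i Red) \<le> mono_value n k r b"
proof -
  obtain h where h: "\<And>i. i \<in> {1..k} \<Longrightarrow> color_count n h i Red = b i"
    using coloring_with_counts[of k b n] assms(3) by blast
  have "num_mono n k r g \<le> num_mono n k r h"
    using assms(1) by (simp add: minimizing_def)
  then have "mono_value n k r (\<lambda>i. color_count n g i Red)
      \<le> mono_value n k r (\<lambda>i. color_count n h i Red)"
    using assms(2) by (simp flip: num_mono_eq_mono_value)
  also have "\<dots> = mono_value n k r b"
    using h by (intro mono_value_cong)
  finally show ?thesis .
qed

section \<open>Comparing a profile with its modifications\<close>

text \<open>Shifting red vertices from class \<open>i\<close> to class \<open>j\<close> keeps both
  color totals, so only the subtracted sum over the classes changes, and convexity makes it
  grow.\<close>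

lemma mono_value_two_bicolored:
  assumes "3 \<le> r" "r \<le> n" "i \<in> {1..k}" "j \<in> {1..k}" "i \<noteq> j"
    and le: "\<And>l. l \<in> {1..k} \<Longrightarrow> a l \<le> n"
    and ij: "0 < a i" "a i \<le> a j" "a j < n"
  obtains b where "\<And>l. l \<in> {1..k} \<Longrightarrow> b l \<le> n" "mono_value n k r b < mono_value n k r a"
proof
  \<comment> \<open>The largest possible shift: class \<open>i\<close> becomes entirely blue or
    class \<open>j\<close> entirely red.\<close>
  define t where "t = min (a i) (n - a j)"
  have t: "0 < t" "t \<le> a i" "t \<le> n - a j" "t = a i \<or> t = n - a j"
    using ij by (auto simp: t_def)
  define b where "b = a(i := a i - t, j := a j + t)"
  let ?R = "{1..k} - {i} - {j}"
  have b: "b i = a i - t" "b j = a j + t"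
    using assms(5) by (auto simp: b_def)
  have j: "j \<in> {1..k} - {i}" using assms(4,5) by simp
  \<comment> \<open>Polymorphic in the result type of \<open>h\<close>, since it serves the two
    totals in \<open>nat\<close> as well as the subtracted sum in \<open>int\<close>.\<close>
  have split: "(\<Sum>l\<in>{1..k}. h (c l)) = h (c i) + (h (c j) + (\<Sum>l\<in>?R. h (c l)))"
    for h :: "nat \<Rightarrow> 'b::comm_monoid_add" and c :: "nat \<Rightarrow> nat"
    by (simp only: sum.remove[OF finite_atLeastAtMost assms(3)]
        sum.remove[OF finite_Diff[OF finite_atLeastAtMost] j])
  have rest: "(\<Sum>l\<in>?R. h (b l)) = (\<Sum>l\<in>?R. h (a l))" for h :: "nat \<Rightarrow> 'b::comm_monoid_add"
    by (rule sum.cong) (auto simp: b_def)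
  have split_b: "(\<Sum>l\<in>{1..k}. h (b l)) = h (a i - t) + (h (a j + t) + (\<Sum>l\<in>?R. h (a l)))"
    for h :: "nat \<Rightarrow> 'b::comm_monoid_add"
    by (simp only: split[of h b] rest b)
  have red: "(\<Sum>l\<in>{1..k}. b l) = (\<Sum>l\<in>{1..k}. a l)"
    unfolding split[of "\<lambda>x. x" a] split_b[of "\<lambda>x. x"] using t(2) by simp
  have e: "a i - t + t = a i" "n - a i + t = n - (a i - t)" "n - (a j + t) + t = n - a j"
    using t ij by auto
  have blue: "(\<Sum>l\<in>{1..k}. n - b l) = (\<Sum>l\<in>{1..k}. n - a l)"
    unfolding split[of "\<lambda>x. n - x" a] split_b[of "\<lambda>x. n - x"] e(2,3)[symmetric] by simp
  have weak: "(a i choose r) + (a j choose r) \<le> ((a i - t) choose r) + ((a j + t) choose r)"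
    "((n - a j) choose r) + ((n - a i) choose r)
      \<le> ((n - (a j + t)) choose r) + ((n - (a i - t)) choose r)"
    using binomial_convex[of "a i - t" "a j" t r] binomial_convex[of "n - (a j + t)" "n - a i" t r] ij(2)
    unfolding e by simp_all
  \<comment> \<open>Strictness comes from the class that becomes unicolored: it has
    \<open>n \<ge> r\<close> vertices of one color, so the convexity inequality for that color is
    strict.\<close>
  have "(a i choose r) + (a j choose r) + (((n - a j) choose r) + ((n - a i) choose r))
    < ((a i - t) choose r) + ((a j + t) choose r)
      + (((n - (a j + t)) choose r) + ((n - (a i - t)) choose r))"
    using t(4)
  proof
    assume "t = a i"
    then have "n - (a j + t) < n - a i" "r \<le> n - a i + t" using t ij assms(2) by simp_all
    then have "((n - a j) choose r) + ((n - a i) choose r)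
      < ((n - (a j + t)) choose r) + ((n - (a i - t)) choose r)"
      using binomial_strict_convex[of "n - (a j + t)" "n - a i" t r] t(1) assms(1) unfolding e by simp
    with weak(1) show ?thesis by (rule add_le_less_mono)
  next
    assume "t = n - a j"
    then have "a i - t < a j" "r \<le> a j + t" using t ij assms(2) by simp_all
    then have "(a i choose r) + (a j choose r) < ((a i - t) choose r) + ((a j + t) choose r)"
      using binomial_strict_convex[of "a i - t" "a j" t r] t(1) assms(1) unfolding e by simp
    then show ?thesis using weak(2) by (rule add_less_le_mono)
  qed
  from of_nat_less_iff[where ?'a = int, THEN iffD2, OF this]
  show "mono_value n k r b < mono_value n k r a"
    unfolding mono_value_def red blue
      split[of "\<lambda>x. int (x choose r) + int ((n - x) choose r)" a]
      split_b[of "\<lambda>x. int (x choose r) + int ((n - x) choose r)"] of_nat_add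
    by linarith
  show "b l \<le> n" if "l \<in> {1..k}" for l
    using le[OF that] t ij by (auto simp: b_def)
qed

text \<open>Besides class \<open>m\<close> there are \<open>p\<close> red and \<open>q\<close> blue
  classes, each contributing \<open>n choose r\<close> to the subtracted sum. The last term is free
  of \<open>y\<close>, so the other four decide how class \<open>m\<close> should be
  colored.\<close>

lemma mono_value_one_bicolored:
  assumes "0 < r" "m \<in> {1..k}" "y \<le> n" "0 < n"
    and ext: "\<And>i. i \<in> {1..k} - {m} \<Longrightarrow> a i = 0 \<or> a i = n"
  defines "p \<equiv> card {i \<in> {1..k} - {m}. a i = n}"
    and "q \<equiv> card {i \<in> {1..k} - {m}. a i = 0}"
  shows "mono_value n k r (a(m := y)) =
    int ((p * n + y) choose r) - int (y choose r)
    + int ((q * n + (n - y)) choose r) - int ((n - y) choose r) - int ((p + q) * (n choose r))"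
proof -
  let ?P = "{i \<in> {1..k} - {m}. a i = n}" and ?Q = "{i \<in> {1..k} - {m}. a i = 0}"
  have PQ: "{1..k} - {m} = ?P \<union> ?Q" "?P \<inter> ?Q = {}"
    using ext assms(4) by (blast, force)
  have split: "(\<Sum>i\<in>{1..k}. h ((a(m := y)) i)) = h y + (of_nat p * h n + of_nat q * h 0)"
    for h :: "nat \<Rightarrow> 'b::comm_semiring_1"
  proof -
    have "(\<Sum>i\<in>{1..k}. h ((a(m := y)) i)) = h y + (\<Sum>i\<in>{1..k} - {m}. h (a i))"
      using assms(2) sum.remove[of "{1..k}" m "\<lambda>i. h ((a(m := y)) i)"] by simp
    also have "(\<Sum>i\<in>{1..k} - {m}. h (a i)) = (\<Sum>i\<in>?P. h (a i)) + (\<Sum>i\<in>?Q. h (a i))"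
      by (subst PQ(1), rule sum.union_disjoint) (use PQ(2) in auto)
    finally show ?thesis by (simp add: p_def q_def)
  qed
  have "(\<Sum>i\<in>{1..k}. (a(m := y)) i) = p * n + y"
    using split[of "\<lambda>x. x"] by simp
  moreover have "(\<Sum>i\<in>{1..k}. n - (a(m := y)) i) = q * n + (n - y)"
    using split[of "\<lambda>x. n - x"] by simp
  moreover have zero: "0 choose r = 0" using assms(1) by (cases r) auto
  ultimately show ?thesis
    unfolding mono_value_def
    using split[of "\<lambda>x. int (x choose r) + int ((n - x) choose r)"]
    by (simp add: zero algebra_simps)
qed

text \<open>The increment with \<open>q\<close> and \<open>z\<close> is at least
  \<open>(q * n) choose s\<close>, which for \<open>p < q\<close> exceeds
  \<open>(p * n + y) choose s\<close> because \<open>y < n\<close>. For \<open>p = q > 0\<close> and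
  \<open>y < z\<close>, strict convexity contradicts the inequality. For \<open>p = q = 0\<close>
  both sides would vanish.\<close>

lemma binomial_increment_le_imp:
  assumes "2 \<le> s" "s \<le> n" "y < n" "0 < p + q"
    and le: "int ((q * n + z) choose s) - int (z choose s) \<le> int ((p * n + y) choose s) - int (y choose s)"
  shows "q < p \<or> q = p \<and> z \<le> y"
proof (rule ccontr)
  assume "\<not> ?thesis"
  then consider "p < q" | "p = q" "y < z" by linarith
  then show False
  proof cases
    case 1
    then have "Suc p * n \<le> q * n" by (intro mult_right_mono) auto
    then have pq: "p * n + y < q * n" "s \<le> q * n"
      using assms(2,3) by (auto intro: order_trans)
    have "(p * n + y) choose s < (q * n) choose s"
      using pq assms(1) by (intro binomial_strict_mono) auto
    moreover have "((q * n) choose s) + (z choose s) \<le> (q * n + z) choose s"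
      using assms(1) by (intro binomial_superadditive) auto
    ultimately show False using le by linarith
  next
    case 2
    then have p: "0 < p" using assms(4) by simp
    then have "n \<le> p * n" by simp
    then have pn: "y < p * n + y" "s \<le> p * n + y + (z - y)"
      using assms(2,3) by (linarith, linarith)
    have "y + (z - y) = z" "p * n + y + (z - y) = p * n + z"
      using 2 by auto
    then have "(z choose s) + ((q * n + y) choose s) < (y choose s) + ((q * n + z) choose s)"
      using binomial_strict_convex[of y "p * n + y" "z - y" s] pn assms(1) 2 by simp
    then show False using le unfolding 2(1) by linarith
  qed
qed

text \<open>Recoloring one vertex of class \<open>m\<close> does not lower the value; by Pascal's
  rule this becomes the hypothesis of \<open>binomial_increment_le_imp\<close> with
  \<open>s = r - 1\<close>. Class \<open>m\<close> may itself be unicolored, in which case just one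
  direction of recoloring is available.\<close>

lemma minimal_one_bicolored:
  assumes "3 \<le> r" "r \<le> n" "2 \<le> k" "m \<in> {1..k}"
    and le: "\<And>i. i \<in> {1..k} \<Longrightarrow> a i \<le> n"
    and ext: "\<And>i. i \<in> {1..k} - {m} \<Longrightarrow> a i = 0 \<or> a i = n"
    and min: "\<And>b. (\<And>i. i \<in> {1..k} \<Longrightarrow> b i \<le> n) \<Longrightarrow> mono_value n k r a \<le> mono_value n k r b"
  defines "p \<equiv> card {i \<in> {1..k} - {m}. a i = n}"
    and "q \<equiv> card {i \<in> {1..k} - {m}. a i = 0}"
  shows "p + q = k - 1"
    and "a m < n \<Longrightarrow> q < p \<or> q = p \<and> n \<le> 2 * a m + 1"
    and "0 < a m \<Longrightarrow> p < q \<or> p = q \<and> 2 * a m \<le> n + 1"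
proof -
  let ?P = "{i \<in> {1..k} - {m}. a i = n}" and ?Q = "{i \<in> {1..k} - {m}. a i = 0}"
  have "?P \<union> ?Q = {1..k} - {m}" "?P \<inter> ?Q = {}"
    using ext assms(1,2) by (blast, force)
  then have "p + q = card ({1..k} - {m})"
    unfolding p_def q_def by (subst card_Un_disjoint[symmetric]) auto
  then show pq: "p + q = k - 1" using assms(4) by simp
  have pq': "0 < p + q" "0 < q + p" using pq assms(3) by auto
  define s where "s = r - 1"
  have r: "r = Suc s" using assms(1) by (simp add: s_def)
  let ?G = "\<lambda>y. int ((p * n + y) choose r) - int (y choose r)
    + int ((q * n + (n - y)) choose r) - int ((n - y) choose r)"
  have G: "mono_value n k r (a(m := y)) = ?G y - int ((p + q) * (n choose r))" if "y \<le> n" for y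
    unfolding p_def q_def
    by (rule mono_value_one_bicolored) (use assms(1,2,4) ext that in auto)
  have G_le: "?G (a m) \<le> ?G y" if "y \<le> n" for y
  proof -
    have "mono_value n k r (a(m := a m)) \<le> mono_value n k r (a(m := y))"
      using le that by (simp, intro min) auto
    then show ?thesis
      unfolding G[OF that] G[OF le[OF assms(4)]] by linarith
  qed
  show "q < p \<or> q = p \<and> n \<le> 2 * a m + 1" if "a m < n"
  proof -
    \<comment> \<open>The blue vertices left in class \<open>m\<close> after one of them turns
      red.\<close>
    define z where "z = n - Suc (a m)"
    have z: "n = Suc (a m + z)" using that by (simp add: z_def)
    have "int ((q * n + z) choose s) - int (z choose s)
        \<le> int ((p * n + a m) choose s) - int (a m choose s)"
    proof -
      have e: "n - a m = Suc z" "n - Suc (a m) = z" using z by auto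
      show ?thesis using G_le[of "Suc (a m)"] that unfolding e by (simp add: r)
    qed
    from binomial_increment_le_imp[OF _ _ _ _ this]
    have "q < p \<or> q = p \<and> z \<le> a m" using that pq' assms(1,2) r by simp
    then show ?thesis using z by auto
  qed
  show "p < q \<or> p = q \<and> 2 * a m \<le> n + 1" if "0 < a m"
  proof -
    \<comment> \<open>The red vertices left in class \<open>m\<close> after one of them turns
      blue.\<close>
    define y where "y = a m - 1"
    have y: "a m = Suc y" using that by (simp add: y_def)
    define z where "z = n - a m"
    have z: "n = Suc (y + z)" using y le[OF assms(4)] by (simp add: z_def)
    have "int ((p * n + y) choose s) - int (y choose s)
        \<le> int ((q * n + z) choose s) - int (z choose s)"
    proof -
      have e: "n - a m = z" "n - y = Suc z" using z y by auto
      show ?thesis using G_le[of y] z unfolding e by (simp add: r y)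
    qed
    from binomial_increment_le_imp[OF _ _ _ _ this]
    have "p < q \<or> p = q \<and> y \<le> z" using z pq' assms(1,2) r by simp
    then show ?thesis using z y by auto
  qed
qed

section \<open>Red counts of minimizing colorings\<close>

text \<open>The cardinalities leave exactly one class with value \<open>x\<close> if
  \<open>k\<close> is odd and none if \<open>k\<close> is even. In the even case \<open>x\<close> is
  a mere placeholder, which lets both parities share one notion.\<close>

definition balanced_counts :: "nat \<Rightarrow> nat \<Rightarrow> nat \<Rightarrow> (nat \<Rightarrow> nat) \<Rightarrow> bool" where
  "balanced_counts n k x a \<longleftrightarrow> 0 < x \<and> x < n \<and>
     (\<forall>i\<in>{1..k}. a i = n \<or> a i = 0 \<or> a i = x) \<and>
     card {i \<in> {1..k}. a i = n} = k div 2 \<and> card {i \<in> {1..k}. a i = 0} = k div 2"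

lemma minimal_imp_balanced_counts:
  assumes "3 \<le> r" "r \<le> n" "2 \<le> k"
    and le: "\<And>i. i \<in> {1..k} \<Longrightarrow> a i \<le> n"
    and min: "\<And>b. (\<And>i. i \<in> {1..k} \<Longrightarrow> b i \<le> n) \<Longrightarrow> mono_value n k r a \<le> mono_value n k r b"
  obtains x where "balanced_counts n k x a" "n \<le> 2 * x + 1" "2 * x \<le> n + 1"
proof -
  let ?P = "{i \<in> {1..k}. a i = n}" and ?Q = "{i \<in> {1..k}. a i = 0}"
  show thesis
  proof (cases "\<exists>m\<in>{1..k}. 0 < a m \<and> a m < n")
    case True
    then obtain m where m: "m \<in> {1..k}" "0 < a m" "a m < n" by blast
    have ext: "a i = 0 \<or> a i = n" if i: "i \<in> {1..k} - {m}" for i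
    proof (rule ccontr)
      assume "\<not> ?thesis"
      then have ai: "0 < a i" "a i < n" using le[of i] i by auto
      have "\<exists>b. (\<forall>l\<in>{1..k}. b l \<le> n) \<and> mono_value n k r b < mono_value n k r a"
      \<comment> \<open>The class with fewer red vertices gives, the other one receives.\<close>
      proof (cases "a i \<le> a m")
        case True
        show ?thesis
          by (rule mono_value_two_bicolored[OF assms(1,2) _ m(1) _ le ai(1) True m(3)])
            (use i in blast)+
      next
        case False
        then have "a m \<le> a i" by simp
        show ?thesis
          by (rule mono_value_two_bicolored[OF assms(1,2) m(1) _ _ le m(2) \<open>a m \<le> a i\<close> ai(2)])
            (use i in blast)+
      qed
      then show False using min by (meson not_less)
    qed
    have eq: "{i \<in> {1..k} - {m}. a i = n} = ?P" "{i \<in> {1..k} - {m}. a i = 0} = ?Q"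
      using m by auto
    note one = minimal_one_bicolored[OF assms(1-3) m(1) le ext min, unfolded eq]
    have sum: "card ?P + card ?Q = k - 1"
      by (rule one(1)) simp_all
    have "card ?Q < card ?P \<or> card ?Q = card ?P \<and> n \<le> 2 * a m + 1"
      by (rule one(2)) (use m in simp_all)
    moreover have "card ?P < card ?Q \<or> card ?P = card ?Q \<and> 2 * a m \<le> n + 1"
      by (rule one(3)) (use m in simp_all)
    \<comment> \<open>Class \<open>m\<close> allows recoloring in both directions, and the two
      strict alternatives exclude each other.\<close>
    ultimately have PQ: "card ?P = card ?Q" and x: "n \<le> 2 * a m + 1" "2 * a m \<le> n + 1"
      by linarith+
    have "card ?P = k div 2" "card ?Q = k div 2"
      using sum assms(3) unfolding PQ by simp_all
    moreover have "a i = n \<or> a i = 0 \<or> a i = a m" if "i \<in> {1..k}" for i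
      using ext[of i] that by blast
    ultimately have "balanced_counts n k (a m) a"
      unfolding balanced_counts_def using m by blast
    then show thesis using that x by blast
  next
    case False
    then have ext: "a i = 0 \<or> a i = n" if "i \<in> {1..k}" for i
      using le that by (metis le_neq_implies_less neq0_conv)
    \<comment> \<open>Turning one vertex of a red class blue compares the remaining
      \<open>card ?P - 1\<close> red classes with the blue ones. The tie would require
      \<open>2 * n \<le> n + 1\<close>, impossible for \<open>n \<ge> 3\<close>. The reverse
      inequality is symmetric.\<close>
    have PQ: "card ?P \<le> card ?Q"
    proof (cases "?P = {}")
      case False
      then obtain m where m: "m \<in> {1..k}" "a m = n" by blast
      have eq: "{i \<in> {1..k} - {m}. a i = n} = ?P - {m}" "{i \<in> {1..k} - {m}. a i = 0} = ?Q"
        using m assms(1,2) by auto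
      have "card ?P - 1 < card ?Q"
        using minimal_one_bicolored(3)[OF assms(1-3) m(1) le ext min, unfolded eq] m assms(1,2)
        by auto
      then show ?thesis by linarith
    qed (simp only: card.empty le0)
    have QP: "card ?Q \<le> card ?P"
    proof (cases "?Q = {}")
      case False
      then obtain m where m: "m \<in> {1..k}" "a m = 0" by blast
      have eq: "{i \<in> {1..k} - {m}. a i = n} = ?P" "{i \<in> {1..k} - {m}. a i = 0} = ?Q - {m}"
        using m assms(1,2) by auto
      have "card ?Q - 1 < card ?P"
        using minimal_one_bicolored(2)[OF assms(1-3) m(1) le ext min, unfolded eq] m assms(1,2)
        by auto
      then show ?thesis by linarith
    qed (simp only: card.empty le0)
    have "?P \<union> ?Q = {1..k}" "?P \<inter> ?Q = {}"
      using ext assms(1,2) by (blast, force)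
    then have "card ?P + card ?Q = k"
      by (metis (no_types, lifting) card_Un_disjoint card_atLeastAtMost diff_Suc_1 finite_Un
          finite_atLeastAtMost)
    then have "card ?P = k div 2" "card ?Q = k div 2" using PQ QP by auto
    moreover have "a i = n \<or> a i = 0 \<or> a i = n div 2" if "i \<in> {1..k}" for i
      using ext[OF that] by blast
    \<comment> \<open>No class attains the placeholder \<open>n div 2\<close>; it is chosen to
      satisfy the two bounds on \<open>x\<close>.\<close>
    ultimately have "balanced_counts n k (n div 2) a"
      unfolding balanced_counts_def using assms(1,2) by simp
    then show thesis using that by force
  qed
qed

section \<open>Symmetries of balanced profiles\<close>

text \<open>This is the effect of exchanging the colors, needed when two colorings give the extra
  vertex of the bicolored class to different colors.\<close>

lemma balanced_counts_complement:
  assumes "balanced_counts n k x a" and "\<And>i. i \<in> {1..k} \<Longrightarrow> a i \<le> n"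
  shows "balanced_counts n k (n - x) (\<lambda>i. n - a i)"
proof -
  have "{i \<in> {1..k}. n - a i = n} = {i \<in> {1..k}. a i = 0}"
    "{i \<in> {1..k}. n - a i = 0} = {i \<in> {1..k}. a i = n}"
    using assms unfolding balanced_counts_def by force+
  then show ?thesis
    using assms unfolding balanced_counts_def by auto
qed

text \<open>The multiplicity of each value depends only on \<open>n\<close>, \<open>k\<close> and
  \<open>x\<close>, so two balanced profiles with the same \<open>x\<close> agree as multisets and
  hence up to a permutation of the classes.\<close>

lemma balanced_counts_card:
  assumes "balanced_counts n k x a"
  shows "card {i \<in> {1..k}. a i = y} =
    (if y = n \<or> y = 0 then k div 2 else if y = x then k - 2 * (k div 2) else 0)"
proof -
  let ?C = "\<lambda>y. {i \<in> {1..k}. a i = y}"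
  have x: "0 < x" "x < n" using assms by (auto simp: balanced_counts_def)
  have cases: "a i = n \<or> a i = 0 \<or> a i = x" if "i \<in> {1..k}" for i
    using assms that by (auto simp: balanced_counts_def)
  have nz: "card (?C n) = k div 2" "card (?C 0) = k div 2"
    using assms by (auto simp: balanced_counts_def)
  have "{1..k} = (?C n \<union> ?C 0) \<union> ?C x" using cases by blast
  then have "card {1..k} = card ((?C n \<union> ?C 0) \<union> ?C x)" by (rule arg_cong)
  also have "\<dots> = card (?C n) + card (?C 0) + card (?C x)"
    using x by (subst card_Un_disjoint, force, force, force, subst card_Un_disjoint) auto
  finally have Cx: "card (?C x) = k - 2 * (k div 2)" using nz by simp
  show ?thesis
  proof (cases "y = n \<or> y = 0 \<or> y = x")
    case False
    then have "?C y = {}" using cases by blast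
    then show ?thesis using False by simp
  qed (use nz Cx x in auto)
qed

lemma balanced_counts_permutes:
  assumes "balanced_counts n k x a" "balanced_counts n k x b"
  obtains \<pi> where "\<pi> permutes {1..k}" "\<And>i. i \<in> {1..k} \<Longrightarrow> b (\<pi> i) = a i"
proof -
  have "image_mset a (mset_set {1..k}) = image_mset b (mset_set {1..k})"
    using balanced_counts_card[OF assms(1)] balanced_counts_card[OF assms(2)]
    by (intro multiset_eqI) (simp add: count_image_mset_eq_card_vimage)
  then show thesis
    using image_mset_eq_implies_permutes[of "{1..k}" a b] that
    by (metis finite_atLeastAtMost)
qed

section \<open>Balanced colorings and uniqueness\<close>

lemma balanced_coloring_counts:
  assumes "balanced_coloring n k f" "2 \<le> n"
  obtains x where "balanced_counts n k x (\<lambda>i. color_count n f i Red)"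
    "n \<le> 2 * x + 1" "2 * x \<le> n + 1"
proof -
  let ?a = "\<lambda>i. color_count n f i Red"
  have red: "?a i = n" if "i \<in> {1..k div 2}" for i
  proof -
    have "{v \<in> vclass n i. f v = Red} = vclass n i"
      using assms(1) that by (auto simp: balanced_coloring_def)
    then show ?thesis by (simp add: color_count_def)
  qed
  have blue: "?a i = 0" if "i \<in> {k - k div 2<..k}" for i
  proof -
    have "f v = Blue" if "v \<in> vclass n i" for v
      using assms(1) that \<open>i \<in> _\<close> unfolding balanced_coloring_def by blast
    then have "{v \<in> vclass n i. f v = Red} = {}" by auto
    then show ?thesis by (simp add: color_count_def)
  qed
  have mid: "n \<le> 2 * ?a i + 1" "2 * ?a i \<le> n + 1" if "i \<in> {k div 2<..k - k div 2}" for i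
  proof -
    have "\<bar>int (?a i) - int (color_count n f i Blue)\<bar> \<le> 1"
      using assms(1) that by (simp add: balanced_coloring_def)
    then show "n \<le> 2 * ?a i + 1" "2 * ?a i \<le> n + 1"
      using color_count_add[of n f i] by auto
  qed
  \<comment> \<open>For odd \<open>k\<close> the only middle class is \<open>Suc (k div 2)\<close>;
    for even \<open>k\<close> there is none and \<open>n div 2\<close> is the placeholder.\<close>
  define x where "x = (if even k then n div 2 else ?a (Suc (k div 2)))"
  have x: "n \<le> 2 * x + 1" "2 * x \<le> n + 1"
    using mid[of "Suc (k div 2)"] by (auto simp: x_def elim!: oddE)
  have classes: "i \<in> {1..k div 2} \<or> i \<in> {k - k div 2<..k} \<or>
      odd k \<and> i = Suc (k div 2) \<and> i \<in> {k div 2<..k - k div 2}" if "i \<in> {1..k}" for i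
    using that by (auto elim!: oddE evenE)
  have val: "i \<in> {1..k div 2} \<and> ?a i = n \<or> i \<in> {k - k div 2<..k} \<and> ?a i = 0 \<or> ?a i = x"
    if "i \<in> {1..k}" for i
    using classes[OF that] red blue by (auto simp: x_def)
  \<comment> \<open>For \<open>n = 1\<close> the bounds would admit \<open>x = 0\<close> and
    \<open>x = n\<close>; \<open>2 \<le> n\<close> rules this out.\<close>
  have x': "0 < x" "x < n" using x assms(2) by auto
  have n: "{i \<in> {1..k}. ?a i = n} = {1..k div 2}"
  proof (intro equalityI subsetI)
    fix i assume "i \<in> {i \<in> {1..k}. ?a i = n}"
    then show "i \<in> {1..k div 2}" using val[of i] x' by auto
  next
    fix i assume i: "i \<in> {1..k div 2}"
    then have "i \<le> k div 2" by simp
    also have "\<dots> \<le> k" by (rule div_le_dividend)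
    finally show "i \<in> {i \<in> {1..k}. ?a i = n}" using red[OF i] i by simp
  qed
  have z: "{i \<in> {1..k}. ?a i = 0} = {k - k div 2<..k}"
    using val blue x' by fastforce
  have "?a i = n \<or> ?a i = 0 \<or> ?a i = x" if "i \<in> {1..k}" for i
    using val[OF that] by blast
  then have "balanced_counts n k x ?a"
    unfolding balanced_counts_def n z using x' by simp
  then show thesis using that x by blast
qed

lemma same_up_to_permutation_num_mono:
  assumes "same_up_to_permutation n k f g" "0 < r"
  shows "num_mono n k r f = num_mono n k r g"
proof -
  obtain \<pi> \<sigma> where \<pi>: "\<pi> permutes {1..k}" and \<sigma>: "bij \<sigma>"
    and eq: "\<And>i c. i \<in> {1..k} \<Longrightarrow> color_count n g (\<pi> i) (\<sigma> c) = color_count n f i c"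
    using assms(1) unfolding same_up_to_permutation_def by blast
  have sum_eq: "(\<Sum>i\<in>{1..k}. h (color_count n f i c)) = (\<Sum>i\<in>{1..k}. h (color_count n g i (\<sigma> c)))"
    for h :: "nat \<Rightarrow> 'b::comm_monoid_add" and c
    using sum.permute[OF \<pi>, of "\<lambda>i. h (color_count n g i (\<sigma> c))"] eq by (simp add: o_def)
  \<comment> \<open>A bijection of the two colors is the identity or the swap, and
    \<open>mono_value\<close> is symmetric under both.\<close>
  have "\<sigma> Red \<noteq> \<sigma> Blue" using \<sigma> by (metis bij_pointE color.distinct(1))
  then have "\<sigma> Red = Red \<and> \<sigma> Blue = Blue \<or> \<sigma> Red = Blue \<and> \<sigma> Blue = Red"
    by (metis color.exhaust)
  then have "mono_value n k r (\<lambda>i. color_count n f i Red) = mono_value n k r (\<lambda>i. color_count n g i Red)"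
    unfolding mono_value_def color_count_Blue[symmetric] sum.distrib
    using sum_eq[of "\<lambda>x. x"] sum_eq[of "\<lambda>x. int (x choose r)"] by auto
  then show ?thesis
    using assms(2) by (simp flip: num_mono_eq_mono_value)
qed

lemma minimizing_imp_same_up_to_permutation:
  assumes "r \<le> n" "3 \<le> r" "2 \<le> k" "balanced_coloring n k f" "minimizing n k r g"
  shows "same_up_to_permutation n k f g"
proof -
  have r: "0 < r" using assms(2) by simp
  let ?a = "\<lambda>i. color_count n f i Red" and ?b = "\<lambda>i. color_count n g i Red"
  obtain x where x: "balanced_counts n k x ?b" "n \<le> 2 * x + 1" "2 * x \<le> n + 1"
    using minimal_imp_balanced_counts[OF assms(2,1,3) color_count_Red_le
        minimizing_mono_value_le[OF assms(5) r]] by metis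
  obtain x0 where x0: "balanced_counts n k x0 ?a" "n \<le> 2 * x0 + 1" "2 * x0 \<le> n + 1"
    using balanced_coloring_counts[OF assms(4)] assms(1,2) by auto
  \<comment> \<open>Both numbers are \<open>n / 2\<close> rounded up or down, so they are equal or
    add up to \<open>n\<close>.\<close>
  have "x = x0 \<or> n - x = x0" using x x0 by linarith
  then show ?thesis
  proof
    assume "x = x0"
    then obtain \<pi> where \<pi>: "\<pi> permutes {1..k}" "\<And>i. i \<in> {1..k} \<Longrightarrow> ?b (\<pi> i) = ?a i"
      using balanced_counts_permutes x0(1) x(1) by blast
    have "color_count n g (\<pi> i) (id c) = color_count n f i c" if "i \<in> {1..k}" for i c
      using \<pi>(2)[OF that] by (cases c) (auto simp: color_count_Blue)
    then show ?thesis
      unfolding same_up_to_permutation_def using \<pi>(1) bij_id by blast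
  next
    assume "n - x = x0"
    then have "balanced_counts n k x0 (\<lambda>i. n - ?b i)"
      using balanced_counts_complement[OF x(1) color_count_Red_le] by simp
    then obtain \<pi> where \<pi>: "\<pi> permutes {1..k}" "\<And>i. i \<in> {1..k} \<Longrightarrow> n - ?b (\<pi> i) = ?a i"
      using balanced_counts_permutes[OF x0(1)] by blast
    define \<sigma> where "\<sigma> c = (case c of Red \<Rightarrow> Blue | Blue \<Rightarrow> Red)" for c
    have "\<sigma> (\<sigma> c) = c" for c by (cases c) (auto simp: \<sigma>_def)
    then have "bij \<sigma>" by (intro o_bij[of \<sigma>]) auto
    moreover have "color_count n g (\<pi> i) (\<sigma> c) = color_count n f i c" if "i \<in> {1..k}" for i c
      using \<pi>(2)[OF that] color_count_Red_le[of n g "\<pi> i"]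
      by (cases c) (auto simp: color_count_Blue \<sigma>_def)
    ultimately show ?thesis
      unfolding same_up_to_permutation_def using \<pi>(1) by blast
  qed
qed

theorem theorem2:
  fixes n k r :: nat and f :: "vertex \<Rightarrow> color"
  assumes "n \<ge> r" and "r \<ge> 3" and "k \<ge> 2"
    and "balanced_coloring n k f"
  shows "minimizing n k r f \<and>
         (\<forall>g. minimizing n k r g \<longrightarrow> same_up_to_permutation n k f g)"
proof
  show "\<forall>g. minimizing n k r g \<longrightarrow> same_up_to_permutation n k f g"
    using minimizing_imp_same_up_to_permutation[OF assms] by blast
  \<comment> \<open>Optimality of \<open>f\<close> follows from uniqueness: some minimizer
    \<open>g\<close> exists because the counts are natural numbers, and \<open>f\<close> agrees with
    it up to permutation, so it has equally many monochromatic edges.\<close>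
  obtain g where g: "minimizing n k r g"
    unfolding minimizing_def
    using ex_has_least_nat[of "\<lambda>_. True" undefined "num_mono n k r"] by auto
  have "num_mono n k r f = num_mono n k r g"
    using same_up_to_permutation_num_mono[OF minimizing_imp_same_up_to_permutation[OF assms g]] assms(2)
    by simp
  then show "minimizing n k r f"
    using g by (simp add: minimizing_def)
qed

end
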